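(* Let $\pi$ be a $132$-sortable permutation with left-to-right minima $m_1>m_2>\dots>m_t$, and let $m_0=+\infty$. For each $i=1,\dots,t$, let $H_i$ be the subsequence of $\pi$ consisting of the entries $x$ with $m_i<x<m_{i-1}$. Then $H_i$ avoids both $132$ and $213$, for every $i$.
   Context: An entry of a permutation is a left-to-right minimum if it is smaller than all entries preceding it. A sequence avoids a pattern $\tau$ if none of its subsequences is order isomorphic to $\tau$. For a permutation $\sigma$ of length at least $2$, the $\sigma$-stack acts on an input permutation $\pi=\pi_1\cdots\pi_n$ as follows (starting with empty stack and output). For $i=1,\dots,n$: as long as pushing $\pi_i$ on top of the stack would make the content of the stack, read from top to bottom, contain an occurrence of $\sigma$, pop the top element and append it to the output; then push $\pi_i$. After all letters have been pushed, pop all remaining elements, from top to bottom, appending them to the output. The resulting output is denoted $\mathcal{S}^{\sigma}(\pi)$. The permutation $\pi$ of length $n$ is $\sigma$-sortable if $\mathcal{S}^{21}(\mathcal{S}^{\sigma}(\pi))=12\cdots n$. *)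

theory Defs
  imports
    "HOL-Library.Sublist"
    "HOL-Library.Extended_Nat"
    "HOL-Combinatorics.Multiset_Permutations"
begin

text \<open>
  A permutation of length \<open>n\<close> is a list in \<open>permutations_of_set {1..n}\<close> (one-line notation).
  Patterns such as 132 are written as lists, here \<open>[1, 3, 2]\<close>.
\<close>

definition order_isomorphic :: "nat list \<Rightarrow> nat list \<Rightarrow> bool" where
  "order_isomorphic xs ys \<longleftrightarrow>
     length xs = length ys \<and>
     (\<forall>i<length xs. \<forall>j<length xs. xs ! i < xs ! j \<longleftrightarrow> ys ! i < ys ! j)"

definition contains :: "nat list \<Rightarrow> nat list \<Rightarrow> bool" where
  "contains xs \<tau> \<longleftrightarrow> (\<exists>ys. subseq ys xs \<and> order_isomorphic ys \<tau>)"

definition avoids :: "nat list \<Rightarrow> nat list \<Rightarrow> bool" where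
  "avoids xs \<tau> \<longleftrightarrow> \<not> contains xs \<tau>"

text \<open>
  A state is a pair (stack, output). The head of the stack list is the top of the stack, so the
  list is the stack content read from top to bottom; the output is in the order of production.
  On an empty stack the letter is pushed without a test: a pattern of length at least 2 cannot
  occur in a single letter.
\<close>

fun push_letter :: "nat list \<Rightarrow> nat \<Rightarrow> nat list \<times> nat list \<Rightarrow> nat list \<times> nat list" where
  "push_letter \<sigma> x ([], out) = ([x], out)"
| "push_letter \<sigma> x (s # st, out) =
     (if contains (x # s # st) \<sigma> then push_letter \<sigma> x (st, out @ [s])
      else (x # s # st, out))"

definition pattern_stack :: "nat list \<Rightarrow> nat list \<Rightarrow> nat list" where
  "pattern_stack \<sigma> \<pi> =
     (case fold (push_letter \<sigma>) \<pi> ([], []) of (st, out) \<Rightarrow> out @ st)"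

definition sortable :: "nat list \<Rightarrow> nat list \<Rightarrow> bool" where
  "sortable \<sigma> \<pi> \<longleftrightarrow> pattern_stack [2, 1] (pattern_stack \<sigma> \<pi>) = [1..<Suc (length \<pi>)]"

definition lr_minima :: "nat list \<Rightarrow> nat list" where
  "lr_minima \<pi> = [\<pi> ! k. k \<leftarrow> [0..<length \<pi>], \<forall>l<k. \<pi> ! k < \<pi> ! l]"

text \<open>
  \<open>lr_min \<pi> i\<close> is \<open>m\<^sub>i\<close>, meaningful for \<open>i \<le> length (lr_minima \<pi>)\<close>; indices start at 1,
  hence the shift in the list access.
\<close>

definition lr_min :: "nat list \<Rightarrow> nat \<Rightarrow> enat" where
  "lr_min \<pi> i = (if i = 0 then \<infinity> else enat (lr_minima \<pi> ! (i - 1)))"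

definition strip :: "nat list \<Rightarrow> nat \<Rightarrow> nat list" where
  "strip \<pi> i = filter (\<lambda>x. lr_min \<pi> i < enat x \<and> enat x < lr_min \<pi> (i - 1)) \<pi>"

end

theory Submission
  imports Defs
begin

text \<open>
  Think of output followed by stack, the latter read from top to bottom, as one word. Pushing a
  letter \<open>y\<close> moves the boundary between the two parts to the right and then inserts \<open>y\<close> at the
  boundary; so the relative order of two letters in the final word is settled as soon as both have
  entered: the earlier one comes first exactly if it has been popped by then.

  Let \<open>\<pi> = P @ m # Q\<close> where \<open>m\<close> is a left-to-right minimum. When \<open>m\<close> is pushed, what lies below it
  has to increase from top to bottom, and hence \<open>m\<close> is never popped again. All letters of \<open>Q\<close>
  therefore precede \<open>m\<close> in the final word \<open>w\<close>. Sortability by the second stack forces \<open>w\<close> to avoid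
  231, and \<open>m\<close> may play the 1: the letters larger than \<open>m\<close> that precede \<open>m\<close> in \<open>w\<close> must decrease
  (\<open>decreasing_above\<close>).

  If \<open>b, a, c\<close> forms a 213 in \<open>Q\<close> above \<open>m\<close>, then \<open>b\<close> must be popped before \<open>a\<close> enters, so it precedes
  the later and larger letter \<open>c\<close>: a contradiction.

  If \<open>a, c, b\<close> forms a 132 in \<open>Q\<close> above \<open>m\<close>, then \<open>a\<close> must still be in the stack when \<open>b\<close> has entered,
  while \<open>c\<close> must have been popped. Suppose that \<open>c\<close> is popped on behalf of \<open>y\<close>, and let \<open>z\<close> be the
  last letter popped on behalf of \<open>y\<close>. Some \<open>q\<close> below \<open>z\<close> was the reason, with \<open>y < q < z\<close>. If
  \<open>y < m\<close> then \<open>y, a, m\<close> is a 132 in the stack. Otherwise \<open>q > m\<close>. If \<open>q\<close> lies above \<open>m\<close> in the stack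
  then \<open>y, q\<close> is an ascent above \<open>m\<close> in the final word. If \<open>q\<close> lies below \<open>m\<close> then it belongs
  to \<open>P\<close>, and it is smaller than \<open>z \<le> c\<close>. This last case is excluded if \<open>c\<close> is smaller than all of \<open>P\<close>,
  and this is what membership in a strip provides: every entry before \<open>m\<^sub>i\<close> is at least
  \<open>m\<^bsub>i-1\<^esub>\<close>.
\<close>


section \<open>Occurrences of short patterns\<close>

lemma contains_132_iff:
  "contains xs [1, 3, 2] \<longleftrightarrow> (\<exists>a c b. subseq [a, c, b] xs \<and> a < b \<and> b < c)"
proof
  assume "contains xs [1, 3, 2]"
  then obtain ys where ys: "subseq ys xs" "order_isomorphic ys [1, 3, 2]"
    unfolding contains_def by blast
  then obtain a c b where "ys = [a, c, b]"
    unfolding order_isomorphic_def by (auto simp: length_Suc_conv)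
  with ys show "\<exists>a c b. subseq [a, c, b] xs \<and> a < b \<and> b < c"
    by (auto simp: order_isomorphic_def All_less_Suc)
next
  assume "\<exists>a c b. subseq [a, c, b] xs \<and> a < b \<and> b < c"
  then obtain a c b where "subseq [a, c, b] xs" "a < b" "b < c" by blast
  moreover from this have "order_isomorphic [a, c, b] [1, 3, 2]"
    by (auto simp: order_isomorphic_def All_less_Suc)
  ultimately show "contains xs [1, 3, 2]"
    unfolding contains_def by blast
qed

lemma contains_213D:
  assumes "contains xs [2, 1, 3]"
  shows "\<exists>b a c. subseq [b, a, c] xs \<and> a < b \<and> b < c"
proof -
  obtain ys where ys: "subseq ys xs" "order_isomorphic ys [2, 1, 3]"
    using assms unfolding contains_def by blast
  then obtain b a c where "ys = [b, a, c]"
    unfolding order_isomorphic_def by (auto simp: length_Suc_conv)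
  with ys show ?thesis
    by (auto simp: order_isomorphic_def All_less_Suc)
qed

lemma contains_21I:
  assumes "subseq [c, b] xs" "b < c"
  shows "contains xs [2, 1]"
  using assms unfolding contains_def
  by (intro exI[of _ "[c, b]"]) (auto simp: order_isomorphic_def All_less_Suc)

lemma not_contains_short: "length xs < length \<sigma> \<Longrightarrow> \<not> contains xs \<sigma>"
  unfolding contains_def order_isomorphic_def by (metis linorder_not_less list_emb_length)

lemma subseq_pairI: "x \<in> set xs \<Longrightarrow> y \<in> set ys \<Longrightarrow> subseq [x, y] (xs @ ys)"
  using list_emb_append_mono[of "(=)" "[x]" xs "[y]" ys] by (simp add: subseq_singleton_left)

lemma subseq_threeD:
  assumes "subseq [x, y, z] w"
  obtains w1 w2 w3 w4 where "w = w1 @ x # w2 @ y # w3 @ z # w4"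
proof -
  obtain w1 v where v: "w = w1 @ x # v" "subseq [y, z] v"
    using assms by (blast dest: list_emb_ConsD)
  from v(2) obtain w2 u where u: "v = w2 @ y # u" "subseq [z] u"
    by (blast dest: list_emb_ConsD)
  from u(2) obtain w3 w4 where "u = w3 @ z # w4"
    by (auto simp: subseq_singleton_left dest: split_list)
  with v u that show ?thesis by simp
qed


section \<open>The dynamics of a pattern-avoiding stack\<close>

text \<open>
  The part \<open>V\<close> of the stack is out of reach, because \<open>y\<close> may be pushed directly onto it. The
  last conclusion records why the popping did not stop one letter earlier.
\<close>

lemma push_letter_above:
  assumes "\<not> contains (y # V) \<sigma>"
  obtains U1 U2 where "T = U1 @ U2"
    and "push_letter \<sigma> y (T @ V, out) = ((y # U2) @ V, out @ U1)"
    and "\<not> contains (y # U2 @ V) \<sigma>"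
    and "U1 \<noteq> [] \<longrightarrow> contains (y # last U1 # U2 @ V) \<sigma>"
proof -
  have "\<exists>U1 U2. T = U1 @ U2 \<and> push_letter \<sigma> y (T @ V, out) = ((y # U2) @ V, out @ U1) \<and>
      \<not> contains (y # U2 @ V) \<sigma> \<and> (U1 \<noteq> [] \<longrightarrow> contains (y # last U1 # U2 @ V) \<sigma>)"
  proof (induction T arbitrary: out)
    case Nil
    then show ?case using assms by (cases V) auto
  next
    case (Cons s T)
    show ?case
    proof (cases "contains (y # s # T @ V) \<sigma>")
      case False
      then show ?thesis by (intro exI[of _ "[]"] exI[of _ "s # T"]) simp
    next
      case True
      obtain U1 U2 where *: "T = U1 @ U2"
        "push_letter \<sigma> y (T @ V, out @ [s]) = ((y # U2) @ V, (out @ [s]) @ U1)"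
        "\<not> contains (y # U2 @ V) \<sigma>" "U1 \<noteq> [] \<longrightarrow> contains (y # last U1 # U2 @ V) \<sigma>"
        using Cons.IH[of "out @ [s]"] by blast
      show ?thesis
        by (intro exI[of _ "s # U1"] exI[of _ U2]) (use * True in auto)
    qed
  qed
  with that show ?thesis by blast
qed

text \<open>
  The word formed by output and stack grows by insertions only. This is what transports
  statements about the final word back to every intermediate state.
\<close>

lemma fold_push_letter_above:
  assumes "\<forall>y \<in> set Q. \<not> contains (y # V) \<sigma>"
  obtains T' out' where "fold (push_letter \<sigma>) Q (T @ V, out) = (T' @ V, out @ out')"
    and "subseq (out @ T) ((out @ out') @ T')"
    and "set ((out @ out') @ T') = set (out @ T) \<union> set Q"
proof -
  have "\<exists>T' out'. fold (push_letter \<sigma>) Q (T @ V, out) = (T' @ V, out @ out') \<and>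
      subseq (out @ T) ((out @ out') @ T') \<and>
      set ((out @ out') @ T') = set (out @ T) \<union> set Q"
    using assms
  proof (induction Q arbitrary: T out)
    case Nil
    then show ?case by (intro exI[of _ T] exI[of _ "[]"]) simp
  next
    case (Cons y Q)
    obtain U1 U2 where U: "T = U1 @ U2"
      "push_letter \<sigma> y (T @ V, out) = ((y # U2) @ V, out @ U1)"
      by (rule push_letter_above[of y V \<sigma> T out]) (use Cons.prems in auto)
    obtain T' out' where *:
      "fold (push_letter \<sigma>) Q ((y # U2) @ V, out @ U1) = (T' @ V, (out @ U1) @ out')"
      "subseq ((out @ U1) @ (y # U2)) (((out @ U1) @ out') @ T')"
      "set (((out @ U1) @ out') @ T') = set ((out @ U1) @ (y # U2)) \<union> set Q"
      using Cons.IH[of "y # U2" "out @ U1"] Cons.prems by auto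
    have "subseq (out @ T) ((out @ U1) @ (y # U2))"
      unfolding U(1) by (simp add: list_emb_append_mono subseq_Cons')
    then have "subseq (out @ T) (((out @ U1) @ out') @ T')"
      using *(2) by (rule subseq_order.trans)
    then show ?case
      using U *(1,3) by (intro exI[of _ T'] exI[of _ "U1 @ out'"]) auto
  qed
  with that show ?thesis by blast
qed

text \<open>
  Knuth's criterion: a letter is popped from the 21-avoiding stack by any larger one, so the
  first letter of a 231 leaves before the last one arrives.
\<close>

lemma stack_sorted_avoids_231:
  assumes "sorted (pattern_stack [2, 1] w)" "subseq [b, c, a] w" "a < b" "b < c"
  shows False
proof -
  let ?f = "push_letter [2, 1]"
  obtain w1 w2 w3 w4 where w: "w = w1 @ b # w2 @ c # w3 @ a # w4"
    using assms(2) by (rule subseq_threeD)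
  have free: "\<not> contains (y # []) [2, 1]" for y
    by (rule not_contains_short) simp
  note run = fold_push_letter_above[where V = "[]" and \<sigma> = "[2, 1]", simplified append_Nil2]
  note push = push_letter_above[where V = "[]" and \<sigma> = "[2, 1]", OF free, simplified append_Nil2]
  obtain T1 o1 where 1: "fold ?f (w1 @ b # w2) ([], []) = (T1, o1)"
      "b \<in> set (o1 @ T1)"
    by (rule run[of "w1 @ b # w2" "[]" "[]"]) (use free in auto)
  obtain U1 U2 where 2: "T1 = U1 @ U2" "?f c (T1, o1) = (c # U2, o1 @ U1)"
      "\<not> contains (c # U2) [2, 1]"
    by (rule push[of T1 c o1])
  have "b \<notin> set U2"
    using 2(3) contains_21I[of c b "c # U2"] assms(4) by (auto simp: subseq_singleton_left)
  then have b: "b \<in> set (o1 @ U1)" using 1 2 by auto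
  obtain T3 o3 where 3: "fold ?f w3 (c # U2, o1 @ U1) = (T3, (o1 @ U1) @ o3)"
    by (rule run[of w3 "c # U2" "o1 @ U1"]) (use free in auto)
  obtain X1 X2 where 4: "?f a (T3, (o1 @ U1) @ o3) = (a # X2, ((o1 @ U1) @ o3) @ X1)"
    by (rule push[of T3 a "(o1 @ U1) @ o3"])
  obtain T5 o5 where 5:
      "fold ?f w4 (a # X2, ((o1 @ U1) @ o3) @ X1) = (T5, (((o1 @ U1) @ o3) @ X1) @ o5)"
      "subseq ((((o1 @ U1) @ o3) @ X1) @ a # X2) (((((o1 @ U1) @ o3) @ X1) @ o5) @ T5)"
    by (rule run[of w4 "a # X2" "((o1 @ U1) @ o3) @ X1"]) (use free in auto)
  have "fold ?f w ([], []) = (T5, (((o1 @ U1) @ o3) @ X1) @ o5)"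
    using 1 2 3 4 5 unfolding w by simp
  then have "pattern_stack [2, 1] w = ((((o1 @ U1) @ o3) @ X1) @ o5) @ T5"
    unfolding pattern_stack_def by simp
  moreover have "subseq [b, a] ((((o1 @ U1) @ o3) @ X1) @ a # X2)"
    using b by (intro subseq_pairI) auto
  ultimately have "subseq [b, a] (pattern_stack [2, 1] w)"
    using 5(2) by (metis subseq_order.trans)
  then show False
    using assms(1,3) by (auto dest!: list_emb_ConsD simp: subseq_singleton_left sorted_append)
qed


section \<open>Forbidden patterns above a left-to-right minimum\<close>

definition decreasing_above :: "nat \<Rightarrow> nat list \<Rightarrow> bool" where
  "decreasing_above m w \<longleftrightarrow> (\<forall>x y. subseq [x, y] w \<longrightarrow> m < x \<longrightarrow> y \<le> x)"

lemma decreasing_aboveD: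
  "decreasing_above m w \<Longrightarrow> subseq [x, y] w \<Longrightarrow> m < x \<Longrightarrow> y \<le> x"
  unfolding decreasing_above_def by blast

lemma decreasing_above_subseq:
  "decreasing_above m w \<Longrightarrow> subseq v w \<Longrightarrow> decreasing_above m v"
  unfolding decreasing_above_def by (meson subseq_order.trans)

lemma decreasing_above_prefix_run:
  assumes free: "\<forall>y \<in> set (A @ B). \<not> contains (y # V) \<sigma>"
    and final: "fold (push_letter \<sigma>) (A @ B) (V, out) = (T' @ V, out')"
    and decr: "decreasing_above m (out' @ T')"
  obtains T out1 where "fold (push_letter \<sigma>) A (V, out) = (T @ V, out1)"
    and "decreasing_above m (out1 @ T)" and "set A \<subseteq> set (out1 @ T)"
proof -
  obtain T o1 where 1: "fold (push_letter \<sigma>) A ([] @ V, out) = (T @ V, out @ o1)"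
      "set ((out @ o1) @ T) = set (out @ []) \<union> set A"
    by (rule fold_push_letter_above[of A V \<sigma> "[]" out]) (use free in auto)
  obtain T2 o2 where 2: "fold (push_letter \<sigma>) B (T @ V, out @ o1) = (T2 @ V, (out @ o1) @ o2)"
      "subseq ((out @ o1) @ T) (((out @ o1) @ o2) @ T2)"
    by (rule fold_push_letter_above[of B V \<sigma> T "out @ o1"]) (use free in auto)
  have "T2 = T'" "(out @ o1) @ o2 = out'"
    using 1 2 final by auto
  then have "decreasing_above m ((out @ o1) @ T)"
    using decr 2 decreasing_above_subseq by blast
  moreover have "fold (push_letter \<sigma>) A (V, out) = (T @ V, out @ o1)" using 1 by simp
  ultimately show ?thesis using that[of T "out @ o1"] 1 by auto
qed

lemma no_213_if_decreasing_above:
  assumes free: "\<forall>y \<in> set Q. \<not> contains (y # V) \<sigma>"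
    and final: "fold (push_letter \<sigma>) Q (V, out) = (T' @ V, out')"
    and decr: "decreasing_above m (out' @ T')"
    and occ: "subseq [b, a, c] Q" "m < a" "a < b" "b < c"
  shows False
proof -
  let ?f = "push_letter \<sigma>"
  obtain Q1 Q2 Q3 Q4 where Q: "Q = Q1 @ b # Q2 @ a # Q3 @ c # Q4"
    using occ(1) by (rule subseq_threeD)
  obtain T1 o1 where 1: "fold ?f (Q1 @ b # Q2) (V, out) = (T1 @ V, o1)"
      "b \<in> set (o1 @ T1)"
    by (rule decreasing_above_prefix_run[of "Q1 @ b # Q2" "a # Q3 @ c # Q4" V \<sigma> out T' out' m])
       (use free final decr Q in auto)
  obtain U1 U2 where 2: "T1 = U1 @ U2" "?f a (T1 @ V, o1) = ((a # U2) @ V, o1 @ U1)"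
    by (rule push_letter_above[of a V \<sigma> T1 o1]) (use free Q in auto)
  have "decreasing_above m ((o1 @ U1) @ a # U2)"
    by (rule decreasing_above_prefix_run[of "Q1 @ b # Q2 @ [a]" "Q3 @ c # Q4" V \<sigma> out T' out' m])
       (use free final decr Q 1 2 in auto)
  then have "b \<notin> set U2"
    using decreasing_aboveD[of m _ a b] occ subseq_pairI[of a "(o1 @ U1) @ [a]" b U2] by force
  then have b: "b \<in> set (o1 @ U1)" using 1 2 by auto
  obtain T3 o3 where 3: "fold ?f Q3 ((a # U2) @ V, o1 @ U1) = (T3 @ V, (o1 @ U1) @ o3)"
    by (rule fold_push_letter_above[of Q3 V \<sigma> "a # U2" "o1 @ U1"]) (use free Q in auto)
  obtain X1 X2 where 4: "?f c (T3 @ V, (o1 @ U1) @ o3) = ((c # X2) @ V, ((o1 @ U1) @ o3) @ X1)"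
    by (rule push_letter_above[of c V \<sigma> T3 "(o1 @ U1) @ o3"]) (use free Q in auto)
  have "decreasing_above m ((((o1 @ U1) @ o3) @ X1) @ c # X2)"
    by (rule decreasing_above_prefix_run
          [of "Q1 @ b # Q2 @ a # Q3 @ [c]" Q4 V \<sigma> out T' out' m])
       (use free final decr Q 1 2 3 4 in auto)
  moreover have "subseq [b, c] ((((o1 @ U1) @ o3) @ X1) @ c # X2)"
    using b by (intro subseq_pairI) auto
  ultimately show False
    using decreasing_aboveD occ by fastforce
qed

text \<open>
  The heart of the matter: as long as \<open>a\<close> stays in the stack, the larger letter \<open>c\<close> above it
  cannot be popped. The bound on \<open>S\<close> rules out that a letter below \<open>m\<close> triggers the removal of \<open>c\<close>.
\<close>

lemma no_132_if_decreasing_above: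
  assumes free: "\<forall>y \<in> set Q. \<not> contains (y # m # S) [1, 3, 2]"
    and final: "fold (push_letter [1, 3, 2]) Q (m # S, out) = (T' @ m # S, out')"
    and decr: "decreasing_above m (out' @ T')"
    and dist: "distinct Q" "m \<notin> set Q"
    and low: "\<forall>q \<in> set S. c < q"
    and occ: "subseq [a, c, b] Q" "m < a" "a < b" "b < c"
  shows False
proof -
  let ?\<sigma> = "[1, 3, 2] :: nat list"
  let ?f = "push_letter ?\<sigma>"
  let ?V = "m # S"
  obtain Q1 Q2 Q3 Q4 where Q: "Q = Q1 @ a # Q2 @ c # Q3 @ b # Q4"
    using occ(1) by (rule subseq_threeD)
  let ?A = "Q1 @ a # Q2 @ [c]"
  \<comment> \<open>Once popped, \<open>a\<close> never returns; so \<open>a\<close> in the stack after some step was there before it,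
    which lets the induction on the letters read since \<open>c\<close> carry \<open>c\<close> along.\<close>
  have keep: "\<exists>T o1. fold ?f (?A @ R) (?V, out) = (T @ ?V, o1) \<and>
      \<not> contains (T @ ?V) ?\<sigma> \<and> (a \<in> set T \<longrightarrow> c \<in> set T)"
    if "\<exists>R'. Q = ?A @ R @ R'" for R
    using that
  proof (induction R rule: rev_induct)
    case Nil
    obtain T1 o1 where 1: "fold ?f (Q1 @ a # Q2) (?V, out) = (T1 @ ?V, o1)"
      by (rule decreasing_above_prefix_run
            [of "Q1 @ a # Q2" "c # Q3 @ b # Q4" ?V ?\<sigma> out T' out' m])
         (use free final decr Q in auto)
    obtain U1 U2 where "?f c (T1 @ ?V, o1) = ((c # U2) @ ?V, o1 @ U1)"
        "\<not> contains (c # U2 @ ?V) ?\<sigma>"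
      by (rule push_letter_above[of c ?V ?\<sigma> T1 o1]) (use free Q in auto)
    with 1 show ?case by (intro exI[of _ "c # U2"] exI[of _ "o1 @ U1"]) simp
  next
    case (snoc y R)
    then obtain R' where R': "Q = ?A @ (R @ [y]) @ R'" by blast
    then obtain T1 o1 where 1: "fold ?f (?A @ R) (?V, out) = (T1 @ ?V, o1)"
        "\<not> contains (T1 @ ?V) ?\<sigma>" "a \<in> set T1 \<longrightarrow> c \<in> set T1"
      using snoc.IH by auto
    obtain U1 U2 where 2: "T1 = U1 @ U2" "?f y (T1 @ ?V, o1) = ((y # U2) @ ?V, o1 @ U1)"
        "\<not> contains (y # U2 @ ?V) ?\<sigma>"
        "U1 \<noteq> [] \<longrightarrow> contains (y # last U1 # U2 @ ?V) ?\<sigma>"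
      by (rule push_letter_above[of y ?V ?\<sigma> T1 o1]) (use free R' in auto)
    have run: "fold ?f (?A @ R @ [y]) (?V, out) = ((y # U2) @ ?V, o1 @ U1)"
      using 1 2 by simp
    have decr': "decreasing_above m ((o1 @ U1) @ y # U2)"
      by (rule decreasing_above_prefix_run[of "?A @ R @ [y]" R' ?V ?\<sigma> out T' out' m])
         (use free final decr R' run in auto)
    have False if a: "a \<in> set (y # U2)" and c: "c \<notin> set (y # U2)"
    proof -
      have "y \<noteq> a" "y \<noteq> m" using R' dist by auto
      then have aU: "a \<in> set U2" and cU: "c \<in> set U1"
        using a c 1 2 by auto
      have yam: "\<not> y < m"
      proof
        assume "y < m"
        moreover have "subseq [y, a, m] (y # U2 @ ?V)"
          using subseq_pairI[OF aU, of m ?V] by simp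
        ultimately show False
          using 2(3) occ(2) unfolding contains_132_iff by blast
      qed
      define z where "z = last U1"
      have zU: "z \<in> set U1" using cU z_def by (cases U1) auto
      have U1: "U1 = butlast U1 @ [z]" using cU z_def by (cases U1) auto
      have "subseq ([] @ z # U2 @ ?V) (butlast U1 @ z # U2 @ ?V)"
        by (rule list_emb_append_mono) auto
      then have "subseq (z # U2 @ ?V) (T1 @ ?V)"
        using 2(1) U1 by (metis append.assoc append_Cons append_Nil)
      then have old: "\<not> contains (z # U2 @ ?V) ?\<sigma>"
        using 1(2) unfolding contains_def by (meson subseq_order.trans)
      \<comment> \<open>Neither \<open>y\<close> nor \<open>z\<close> can be dispensed with in the 132 that caused the removal of \<open>z\<close>.\<close>
      have "contains (y # z # U2 @ ?V) ?\<sigma>" using 2(4) cU z_def by auto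
      then obtain u p q where upq: "subseq [u, p, q] (y # z # U2 @ ?V)" "u < q" "q < p"
        unfolding contains_132_iff by blast
      have not: "\<not> subseq [u, p, q] (y # U2 @ ?V)" "\<not> subseq [u, p, q] (z # U2 @ ?V)"
        using 2(3) old upq(2,3) unfolding contains_132_iff by blast+
      then have "u = y" using upq(1) by (auto split: if_splits)
      then have "p = z" using upq(1) not by (auto split: if_splits)
      then have q: "q \<in> set (U2 @ ?V)" "y < q" "q < z"
        using upq \<open>u = y\<close> not by (auto simp: subseq_singleton_left split: if_splits)
      have "m < y" using yam \<open>y \<noteq> m\<close> by simp
      have "q \<notin> set U2"
        using decreasing_aboveD[OF decr', of y q] subseq_pairI[of y "(o1 @ U1) @ [y]" q U2]
          \<open>m < y\<close> q(2) by auto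
      then have "q \<in> set S" using q \<open>m < y\<close> by auto
      then have "c < z" using low q(3) by fastforce
      have "c \<in> set (butlast U1)"
        using cU U1 \<open>c < z\<close> by (metis Un_iff empty_iff less_irrefl list.set set_append singletonD)
      then have "subseq [c, z] (butlast U1 @ [z])"
        by (intro subseq_pairI) auto
      then have "subseq [c, z] U1" using U1 by simp
      then have "subseq [c, z] ((o1 @ U1) @ y # U2)"
        by (simp add: list_emb_append2 list_emb_prefix)
      then show False
        using decreasing_aboveD[OF decr', of c z] \<open>c < z\<close> occ by simp
    qed
    then show ?case using run 2(3) by (intro exI[of _ "y # U2"] exI[of _ "o1 @ U1"]) auto
  qed
  obtain T1 o1 where 1: "fold ?f (?A @ Q3) (?V, out) = (T1 @ ?V, o1)"
      "a \<in> set (o1 @ T1)"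
    by (rule decreasing_above_prefix_run[of "?A @ Q3" "b # Q4" ?V ?\<sigma> out T' out' m])
       (use free final decr Q in auto)
  obtain U1 U2 where 2: "T1 = U1 @ U2" "?f b (T1 @ ?V, o1) = ((b # U2) @ ?V, o1 @ U1)"
    by (rule push_letter_above[of b ?V ?\<sigma> T1 o1]) (use free Q in auto)
  have run: "fold ?f (?A @ Q3 @ [b]) (?V, out) = ((b # U2) @ ?V, o1 @ U1)"
    using 1 2 by simp
  have decr': "decreasing_above m ((o1 @ U1) @ b # U2)"
    by (rule decreasing_above_prefix_run[of "?A @ Q3 @ [b]" Q4 ?V ?\<sigma> out T' out' m])
       (use free final decr Q run in auto)
  have "a \<notin> set (o1 @ U1)"
    using decreasing_aboveD[OF decr', of a b] subseq_pairI[of a "o1 @ U1" b "b # U2"] occ by auto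
  then have "a \<in> set (b # U2)" using 1(2) 2(1) by auto
  then have "c \<in> set (b # U2)"
    using keep[of "Q3 @ [b]"] run Q by auto
  then have "c \<in> set U2" using occ by auto
  then show False
    using decreasing_aboveD[OF decr', of b c] subseq_pairI[of b "(o1 @ U1) @ [b]" c U2] occ by auto
qed

text \<open>
  A descent below \<open>m\<close> would form a 132 with \<open>m\<close>, so the whole stack increases from top to bottom.
  A letter on top of it cannot complete a 132.
\<close>

lemma left_to_right_minimum_never_popped:
  assumes "\<not> contains (m # S) [1, 3, 2]" "\<forall>q \<in> set S. m < q"
  shows "\<not> contains (y # m # S) [1, 3, 2]"
proof
  assume "contains (y # m # S) [1, 3, 2]"
  then obtain u p q where upq: "subseq [u, p, q] (y # m # S)" "u < q" "q < p"
    unfolding contains_132_iff by blast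
  have "\<not> subseq [u, p, q] (m # S)"
    using assms(1) upq(2,3) unfolding contains_132_iff by blast
  then have pq: "subseq [p, q] (m # S)" using upq(1) by (auto split: if_splits)
  have "p \<noteq> m"
  proof
    assume "p = m"
    then have "q \<in> set S" using pq by (simp add: subseq_singleton_left)
    then show False using assms(2) upq(3) \<open>p = m\<close> by fastforce
  qed
  then have S: "subseq [p, q] S" using pq by simp
  then have "q \<in> set S" by (rule list_emb_set[where x = q]) auto
  then have "m < q" using assms(2) by blast
  moreover have "subseq [m, p, q] (m # S)" using S by simp
  ultimately show False
    using assms(1) upq(3) unfolding contains_132_iff by blast
qed

text \<open>
  Since \<open>m\<close> is never popped, it follows \<open>out' @ T'\<close> in the final word and serves as the 1 of a 231.
\<close>

lemma sortable_decreasing_above_minimum: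
  assumes sort: "sortable [1, 3, 2] (P @ m # Q)" and min: "\<forall>p \<in> set P. m < p"
  obtains S out T' out' where "fold (push_letter [1, 3, 2]) Q (m # S, out) = (T' @ m # S, out')"
    and "set S \<subseteq> set P" and "\<forall>y. \<not> contains (y # m # S) [1, 3, 2]"
    and "decreasing_above m (out' @ T')"
proof -
  let ?\<sigma> = "[1, 3, 2] :: nat list"
  let ?f = "push_letter ?\<sigma>"
  have free: "\<not> contains (y # []) ?\<sigma>" for y
    by (rule not_contains_short) simp
  obtain T1 o1 where 1: "fold ?f P ([], []) = (T1, o1)" "set (o1 @ T1) = set P"
    by (rule fold_push_letter_above[of P "[]" ?\<sigma> "[]" "[]"]) (use free in auto)
  obtain U1 S where 2: "T1 = U1 @ S" "?f m (T1, o1) = (m # S, o1 @ U1)"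
      "\<not> contains (m # S) ?\<sigma>"
    by (rule push_letter_above[of m "[]" ?\<sigma> T1 o1]) (use free in auto)
  have S: "set S \<subseteq> set P" using 1 2 by auto
  have stay: "\<forall>y. \<not> contains (y # m # S) ?\<sigma>"
    using left_to_right_minimum_never_popped[OF 2(3)] S min by blast
  obtain T' o' where 3: "fold ?f Q ([] @ m # S, o1 @ U1) = (T' @ m # S, (o1 @ U1) @ o')"
    by (rule fold_push_letter_above[of Q "m # S" ?\<sigma> "[]" "o1 @ U1"]) (use stay in auto)
  define w where "w = ((o1 @ U1) @ o') @ T'"
  have "pattern_stack ?\<sigma> (P @ m # Q) = w @ m # S"
    using 1 2 3 unfolding pattern_stack_def w_def by simp
  then have sorted: "sorted (pattern_stack [2, 1] (w @ m # S))"
    using sort unfolding sortable_def by (simp del: upt_Suc)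
  have "decreasing_above m w"
    unfolding decreasing_above_def
  proof (intro allI impI, rule ccontr)
    fix x y assume xy: "subseq [x, y] w" "m < x" "\<not> y \<le> x"
    have "subseq ([x, y] @ [m]) (w @ m # S)"
      using xy(1) by (rule list_emb_append_mono) simp
    then show False
      using stack_sorted_avoids_231[OF sorted, of x y m] xy by simp
  qed
  moreover have "fold ?f Q (m # S, o1 @ U1) = (T' @ m # S, (o1 @ U1) @ o')"
    using 3 by simp
  ultimately show ?thesis
    using S stay unfolding w_def by (intro that)
qed

lemma sortable_avoids_above_minimum:
  assumes sort: "sortable [1, 3, 2] (P @ m # Q)" and dist: "distinct (P @ m # Q)"
    and min: "\<forall>p \<in> set P. m < p"
    and H: "subseq H Q" "\<forall>x \<in> set H. m < x \<and> (\<forall>p \<in> set P. x < p)"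
  shows "avoids H [1, 3, 2] \<and> avoids H [2, 1, 3]"
proof -
  obtain S out T' out' where
      run: "fold (push_letter [1, 3, 2]) Q (m # S, out) = (T' @ m # S, out')"
    and S: "set S \<subseteq> set P" and stay: "\<forall>y. \<not> contains (y # m # S) [1, 3, 2]"
    and decr: "decreasing_above m (out' @ T')"
    using sortable_decreasing_above_minimum[OF sort min] .
  have mem: "m < x \<and> (\<forall>p \<in> set P. x < p)" if "subseq xs H" "x \<in> set xs" for x xs
    using that(1) by (rule list_emb_set[OF _ that(2)]) (use H(2) in auto)
  have "\<not> contains H [1, 3, 2]"
  proof
    assume "contains H [1, 3, 2]"
    then obtain a c b where occ: "subseq [a, c, b] H" "a < b" "b < c"
      unfolding contains_132_iff by blast
    have "m < a" "\<forall>q \<in> set S. c < q"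
      using mem[OF occ(1)] S by auto
    moreover have "subseq [a, c, b] Q"
      using occ(1) H(1) by (rule subseq_order.trans)
    ultimately show False
      using no_132_if_decreasing_above[OF _ run decr, of c a b] stay dist occ by auto
  qed
  moreover have "\<not> contains H [2, 1, 3]"
  proof
    assume "contains H [2, 1, 3]"
    then obtain b a c where occ: "subseq [b, a, c] H" "a < b" "b < c"
      using contains_213D by blast
    have "m < a" using mem[OF occ(1)] by auto
    moreover have "subseq [b, a, c] Q"
      using occ(1) H(1) by (rule subseq_order.trans)
    ultimately show False
      using no_213_if_decreasing_above[OF _ run decr, of b a c] stay occ by auto
  qed
  ultimately show ?thesis unfolding avoids_def by simp
qed


section \<open>Strips\<close>

definition lr_min_indices :: "nat list \<Rightarrow> nat list" where
  "lr_min_indices \<pi> = filter (\<lambda>k. \<forall>l<k. \<pi> ! k < \<pi> ! l) [0..<length \<pi>]"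

lemma lr_minima_eq: "lr_minima \<pi> = map ((!) \<pi>) (lr_min_indices \<pi>)"
proof -
  have "concat (map (\<lambda>k. if p k then [f k] else []) ks) = map f (filter p ks)"
    for p and f :: "nat \<Rightarrow> nat" and ks :: "nat list"
    by (induction ks) auto
  then show ?thesis unfolding lr_minima_def lr_min_indices_def by simp
qed

lemma lr_min_index_exists:
  assumes "l < length \<pi>"
  shows "\<exists>j \<le> l. j \<in> set (lr_min_indices \<pi>) \<and> \<pi> ! j \<le> \<pi> ! l"
  using assms
proof (induction l rule: less_induct)
  case (less l)
  show ?case
  proof (cases "\<forall>l'<l. \<pi> ! l < \<pi> ! l'")
    case True
    then show ?thesis using less.prems unfolding lr_min_indices_def by auto
  next
    case False
    then obtain l' where "l' < l" "\<pi> ! l' \<le> \<pi> ! l" by (auto simp: not_less)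
    then show ?thesis using less.IH[of l'] less.prems by (meson le_trans less_imp_le less_trans)
  qed
qed

text \<open>
  An entry to the left of \<open>m\<^sub>i\<close> is at least the left-to-right minimum of the prefix that ends with it,
  and this is one of the minima before \<open>m\<^sub>i\<close>. In particular a strip lies entirely to the right of the
  minimum that bounds it from below.
\<close>

lemma previous_lr_min_le_prefix:
  assumes "1 \<le> i" "i \<le> length (lr_minima \<pi>)" "l < lr_min_indices \<pi> ! (i - 1)"
  shows "lr_min \<pi> (i - 1) \<le> enat (\<pi> ! l)"
proof -
  let ?ks = "lr_min_indices \<pi>"
  have i: "i - 1 < length ?ks" using assms(1,2) lr_minima_eq by simp
  have strict: "sorted_wrt (<) ?ks"
    unfolding lr_min_indices_def by (simp add: sorted_wrt_filter)
  have "?ks ! (i - 1) \<in> set ?ks" using i by (rule nth_mem)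
  then have "l < length \<pi>" using assms(3) unfolding lr_min_indices_def by auto
  then obtain j where j: "j \<le> l" "j \<in> set ?ks" "\<pi> ! j \<le> \<pi> ! l"
    using lr_min_index_exists by blast
  then obtain r where r: "r < length ?ks" "?ks ! r = j" by (auto simp: in_set_conv_nth)
  have "r < i - 1"
  proof (rule ccontr)
    assume "\<not> r < i - 1"
    then have "?ks ! (i - 1) \<le> ?ks ! r"
      using strict r(1) by (metis linorder_not_less nat_less_le order_refl sorted_wrt_nth_less)
    then show False using r(2) j(1) assms(3) by simp
  qed
  \<comment> \<open>Minima are numbered from 1 but list positions from 0, so \<open>m\<^bsub>i-1\<^esub>\<close> has position \<open>i - 2\<close>.\<close>
  have "\<pi> ! (?ks ! (i - 2)) \<le> \<pi> ! j"
  proof (cases "r = i - 2")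
    case False
    with \<open>r < i - 1\<close> have "r < i - 2" by simp
    then have "j < ?ks ! (i - 2)"
      using strict r i sorted_wrt_nth_less[OF strict, of r "i - 2"] by simp
    moreover have "?ks ! (i - 2) \<in> set ?ks" using i by (intro nth_mem) simp
    ultimately show ?thesis unfolding lr_min_indices_def by (auto simp: less_imp_le)
  qed (use r in simp)
  moreover have "lr_min \<pi> (i - 1) = enat (\<pi> ! (?ks ! (i - 2)))"
    using \<open>r < i - 1\<close> i unfolding lr_min_def lr_minima_eq by (auto simp: numeral_2_eq_2)
  ultimately show ?thesis using j(3) by simp
qed

theorem proposition5p7:
  fixes \<pi> :: "nat list" and n i :: nat
  assumes "\<pi> \<in> permutations_of_set {1..n}"
    and "sortable [1, 3, 2] \<pi>"
    and "1 \<le> i" and "i \<le> length (lr_minima \<pi>)"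
  shows "avoids (strip \<pi> i) [1, 3, 2] \<and> avoids (strip \<pi> i) [2, 1, 3]"
proof -
  define k where "k = lr_min_indices \<pi> ! (i - 1)"
  define m P Q where "m = \<pi> ! k" and "P = take k \<pi>" and "Q = drop (Suc k) \<pi>"
  have i: "i - 1 < length (lr_min_indices \<pi>)" using assms(3,4) lr_minima_eq by simp
  then have "k \<in> set (lr_min_indices \<pi>)" unfolding k_def by (rule nth_mem)
  then have k: "k < length \<pi>" "\<forall>l<k. m < \<pi> ! l"
    unfolding lr_min_indices_def m_def by auto
  have split: "\<pi> = P @ m # Q"
    unfolding P_def m_def Q_def using k(1) by (rule id_take_nth_drop)
  have min: "\<forall>p \<in> set P. m < p"
    using k unfolding P_def by (auto simp: in_set_conv_nth)
  have lo: "lr_min \<pi> i = enat m"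
    using assms(3) i unfolding lr_min_def lr_minima_eq m_def k_def by simp
  have hi: "\<forall>p \<in> set P. lr_min \<pi> (i - 1) \<le> enat p"
    using previous_lr_min_le_prefix[OF assms(3,4)] k(1) unfolding P_def k_def[symmetric]
    by (auto simp: in_set_conv_nth)
  let ?in = "\<lambda>x. enat m < enat x \<and> enat x < lr_min \<pi> (i - 1)"
  have "filter ?in P = []" using hi by (auto simp: filter_empty_conv)
  then have "filter ?in (P @ m # Q) = filter ?in Q" by simp
  then have strip: "strip \<pi> i = filter ?in Q"
    unfolding strip_def lo using split by simp
  have "distinct (P @ m # Q)"
    using assms(1) split by (metis permutations_of_setD(2))
  moreover have "\<forall>x \<in> set (filter ?in Q). m < x \<and> (\<forall>p \<in> set P. x < p)"
    using hi by (fastforce dest: less_le_trans)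
  ultimately show ?thesis
    unfolding strip using assms(2) split min
    by (intro sortable_avoids_above_minimum[of P m Q]) auto
qed

end
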